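(* Let $n\in\mathbb{N}$, let $\psi:\mathbb{N}\to\mathbb{R}$ be a non-increasing function, and let $A=(\alpha_0,\alpha_1,\dots,\alpha_{n-1})^t\in M_{n,1}$ satisfy $A\notin\mathcal{W}_n^{-}(n,1)$. If $$\sum_{k=1}^{\infty}k^{n-1}\psi(k)<\infty,$$ then $|\mathcal{L}(\mathcal{M}_A,\psi)|=0$, where $|\cdot|$ denotes the volume measure on the hyperplane $\mathcal{M}_A\subset\mathbb{R}^n$.
   Context: $M_{n,1}$ is the set of real matrices with $n$ rows and one column, written $A=(\alpha_i)_{0\le i\le n-1}$. For $v>0$, $\mathcal{W}_v(n,1)$ is the set of all $A=(\alpha_i)_{0\le i\le n-1}\in M_{n,1}$ for which there are infinitely many $q\in\mathbb{Z}$ such that $\max_i|p_i+\alpha_i q|<|q|^{-v}$ for some $\mathbf{p}=(p_0,\dots,p_{n-1})\in\mathbb{Z}^n$. For $v>0$, $\mathcal{W}_v^{-}(n,1)=\bigcap_{0<u<v}\mathcal{W}_u(n,1)$. For $\mathbf{x}=(x_1,\dots,x_{n-1})\in\mathbb{R}^{n-1}$ put $\tilde{\mathbf{x}}=(1,x_1,\dots,x_{n-1})\in\mathbb{R}^n$, so $\tilde{\mathbf{x}}A=\alpha_0+\sum_{i=1}^{n-1}\alpha_i x_i$. The hyperplane attached to $A$ is $\mathcal{M}_A=\{(\mathbf{x},\tilde{\mathbf{x}}A)\mid \mathbf{x}\in\mathbb{R}^{n-1}\}\subset\mathbb{R}^n$; its volume measure is the $(n-1)$-dimensional one. For a submanifold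 $\mathcal{M}\subset\mathbb{R}^n$, $\mathcal{L}(\mathcal{M},\psi)$ is the set of $\mathbf{y}\in\mathcal{M}$ such that for infinitely many $\mathbf{q}\in\mathbb{Z}^n$ there is some $p\in\mathbb{Z}$ with $|p+\mathbf{y}\cdot\mathbf{q}|<\psi(\|\mathbf{q}\|)$, where $\|\mathbf{q}\|=\max\{|q_1|,\dots,|q_n|\}$. (The value $\mathbf q=0$ plays no role.) *)

theory Defs
  imports "HOL-Analysis.Analysis"
begin

text \<open>
  Vectors with coordinates indexed by a finite set \<open>I\<close> are the functions in
  \<open>I \<rightarrow>\<^sub>E UNIV\<close>, so that distinct functions are distinct vectors. A column
  \<open>A\<close> in \<open>M\<^sub>n\<^sub>,\<^sub>1\<close> is indexed by \<open>{..<n}\<close>, points of the ambient \<open>n\<close>-space by \<open>{1..n}\<close>,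
  and points of the parameter space of dimension \<open>n - 1\<close> by \<open>{1..<n}\<close>.
  All notions are meant for \<open>n \<ge> 1\<close>.
\<close>

definition column_matrices :: "nat \<Rightarrow> (nat \<Rightarrow> real) set" where
  "column_matrices n = ({..<n} \<rightarrow>\<^sub>E UNIV)"

definition W_set :: "real \<Rightarrow> nat \<Rightarrow> (nat \<Rightarrow> real) set" where
  "W_set v n = {A \<in> column_matrices n.
     infinite {q :: int. \<exists>p \<in> {..<n} \<rightarrow>\<^sub>E (UNIV :: int set).
       (MAX i\<in>{..<n}. \<bar>of_int (p i) + A i * of_int q\<bar>) < \<bar>of_int q\<bar> powr (- v)}}"

definition W_minus_set :: "real \<Rightarrow> nat \<Rightarrow> (nat \<Rightarrow> real) set" where
  "W_minus_set v n = (\<Inter>u\<in>{0<..<v}. W_set u n)"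

text \<open>\<open>x(0 := 1)\<close> is the row vector \<open>(1, x\<^sub>1, \<dots>, x\<^sub>n\<^sub>-\<^sub>1)\<close>.\<close>

definition tilde_mult :: "nat \<Rightarrow> (nat \<Rightarrow> real) \<Rightarrow> (nat \<Rightarrow> real) \<Rightarrow> real" where
  "tilde_mult n x A = (\<Sum>i<n. (x(0 := 1)) i * A i)"

definition graph_map :: "nat \<Rightarrow> (nat \<Rightarrow> real) \<Rightarrow> (nat \<Rightarrow> real) \<Rightarrow> (nat \<Rightarrow> real)" where
  "graph_map n A x = x(n := tilde_mult n x A)"

definition hyperplane :: "nat \<Rightarrow> (nat \<Rightarrow> real) \<Rightarrow> (nat \<Rightarrow> real) set" where
  "hyperplane n A = graph_map n A ` ({1..<n} \<rightarrow>\<^sub>E UNIV)"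

text \<open>
  The volume element of the graph of \<open>f\<close> is \<open>sqrt (1 + \<bar>grad f\<bar>\<^sup>2) dx\<close>; here
  \<open>grad f = (A 1, \<dots>, A (n - 1))\<close>. For \<open>n = 1\<close> this is the unit mass on the single point.
  The measure lives on the Borel subsets of the hyperplane.
\<close>

definition hyperplane_volume :: "nat \<Rightarrow> (nat \<Rightarrow> real) \<Rightarrow> (nat \<Rightarrow> real) measure" where
  "hyperplane_volume n A =
     scale_measure (ennreal (sqrt (1 + (\<Sum>i=1..<n. (A i)\<^sup>2))))
       (distr (Pi\<^sub>M {1..<n} (\<lambda>_. lborel))
              (restrict_space (Pi\<^sub>M {1..n} (\<lambda>_. borel)) (hyperplane n A))
              (graph_map n A))"

lemma graph_map_measurable:
  assumes "n \<ge> 1"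
  shows "graph_map n A \<in> measurable (Pi\<^sub>M {1..<n} (\<lambda>_. lborel))
           (restrict_space (Pi\<^sub>M {1..n} (\<lambda>_. borel)) (hyperplane n A))"
proof (rule measurable_restrict_space2)
  show "graph_map n A \<in> space (Pi\<^sub>M {1..<n} (\<lambda>_. lborel)) \<rightarrow> hyperplane n A"
    by (auto simp: hyperplane_def space_PiM)
  have I: "{1..n} = insert n {1..<n}"
    using assms by auto
  have t: "(\<lambda>x. tilde_mult n x A) \<in> borel_measurable (Pi\<^sub>M {1..<n} (\<lambda>_. lborel))"
    unfolding tilde_mult_def
  proof (rule borel_measurable_sum)
    fix i assume i: "i \<in> {..<n}"
    show "(\<lambda>x. (x(0 := 1)) i * A i) \<in> borel_measurable (Pi\<^sub>M {1..<n} (\<lambda>_. lborel))"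
    proof (cases "i = 0")
      case False
      then have "i \<in> {1..<n}" using i by auto
      then have "(\<lambda>x. x i) \<in> measurable (Pi\<^sub>M {1..<n} (\<lambda>_. lborel :: real measure)) lborel"
        by (rule measurable_component_singleton)
      then show ?thesis using False by simp
    qed simp
  qed
  have id: "(\<lambda>x. x) \<in> measurable (Pi\<^sub>M {1..<n} (\<lambda>_. lborel)) (Pi\<^sub>M {1..<n} (\<lambda>_. borel :: real measure))"
    by (subst measurable_cong_sets[OF refl sets_PiM_cong[of _ _ _ "\<lambda>_. lborel"]]) auto
  show "graph_map n A \<in> measurable (Pi\<^sub>M {1..<n} (\<lambda>_. lborel)) (Pi\<^sub>M {1..n} (\<lambda>_. borel))"
    unfolding I graph_map_def using measurable_fun_upd[OF refl id t] by simp
qed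

lemma emeasure_hyperplane_volume:
  assumes "n \<ge> 1" "S \<in> sets (restrict_space (Pi\<^sub>M {1..n} (\<lambda>_. borel)) (hyperplane n A))"
  shows "emeasure (hyperplane_volume n A) S =
     ennreal (sqrt (1 + (\<Sum>i=1..<n. (A i)\<^sup>2))) *
     emeasure (Pi\<^sub>M {1..<n} (\<lambda>_. lborel)) {x \<in> {1..<n} \<rightarrow>\<^sub>E UNIV. graph_map n A x \<in> S}"
  unfolding hyperplane_volume_def emeasure_scale_measure
    emeasure_distr[OF graph_map_measurable[OF assms(1)] assms(2)]
  by (rule arg_cong[where f = "\<lambda>X. _ * emeasure _ X"]) (auto simp: space_PiM)

definition approximable_points ::
    "nat \<Rightarrow> (nat \<Rightarrow> real) set \<Rightarrow> (nat \<Rightarrow> real) \<Rightarrow> (nat \<Rightarrow> real) set" where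
  "approximable_points n M \<psi> = {y \<in> M.
     infinite {q \<in> {1..n} \<rightarrow>\<^sub>E (UNIV :: int set). \<exists>p :: int.
       \<bar>of_int p + (\<Sum>i=1..n. y i * of_int (q i))\<bar> < \<psi> (MAX i\<in>{1..n}. nat \<bar>q i\<bar>)}}"

end

theory Submission imports Defs begin

text \<open>
  On \<open>{-R..R}\<^sup>n\<^sup>-\<^sup>1\<close> the quantity \<open>y \<cdot> q\<close>, for \<open>y\<close> the point of the hyperplane over \<open>x\<close>, is
  affine in \<open>x\<close> with constant term \<open>q\<^sub>n \<alpha>\<^sub>0\<close> and gradient \<open>(q\<^sub>i + q\<^sub>n \<alpha>\<^sub>i)\<^sub>i\<close>. Slicing along a
  coordinate where the gradient is \<open>b \<noteq> 0\<close> shows that the set where this quantity is within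
  \<open>\<delta>\<close> of an integer has measure \<open>O(\<delta> (1 + 1 / \<bar>b\<bar>))\<close>.

  If some entry of the gradient is at least \<open>1/2\<close> in absolute value, this is \<open>O(\<delta>)\<close>; there are
  \<open>O(k\<^sup>n\<^sup>-\<^sup>1)\<close> vectors \<open>q\<close> of height \<open>k\<close>, so the Borel-Cantelli lemma applies to these \<open>q\<close>.

  Otherwise \<open>q\<close> is determined by \<open>q\<^sub>n\<close>. With \<open>k = \<bar>q\<^sub>n\<bar>\<close> and \<open>\<delta>\<^sub>k\<close> the distance of \<open>k A\<close> to the
  integer vectors, a nonempty set forces the gradient to be at least a constant times \<open>\<delta>\<^sub>k\<close>,
  and monotonicity gives \<open>\<psi>(k) = O(k\<^sup>-\<^sup>n)\<close>, so it remains to bound \<open>\<Sum>\<^sub>k k\<^sup>-\<^sup>n / \<delta>\<^sub>k\<close>. By hypothesis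
  \<open>\<delta>\<^sub>k \<ge> c k\<^sup>-\<^sup>u\<close> for some \<open>u < n\<close>. Hence the \<open>k\<close> with \<open>\<delta>\<^sub>k\<close> of size about \<open>2\<^sup>-\<^sup>j\<close>, and their
  differences, are at least \<open>d\<close> with \<open>d\<close> of order \<open>2\<^sup>j\<^sup>/\<^sup>u\<close>, and contribute
  \<open>O(2\<^sup>j d\<^sup>-\<^sup>n)\<close>, a geometric series in \<open>j\<close>. For \<open>n = 1\<close> the hypothesis on \<open>A\<close> contradicts
  Dirichlet's theorem.
\<close>

section \<open>Neighbourhoods of integer level sets of affine functions\<close>

text \<open>Only integers within \<open>L\<close> of \<open>- a\<close> can occur, so at most
  \<open>2 * L + 1\<close> of them, and each is responsible for an interval of length
  \<open>2 * \<delta> / \<bar>b\<bar>\<close>. Bounding \<delta> by 1 inside \<open>L\<close>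
  produces the 3. The bound does not depend on \<open>a\<close>, which the slicing argument relies
  on.\<close>

lemma emeasure_affine_near_integer_interval:
  fixes a b R \<delta> :: real
  assumes "b \<noteq> 0" "0 \<le> R" "0 \<le> \<delta>" "\<delta> \<le> 1"
  shows "emeasure lborel {t \<in> {-R..R}. \<exists>p::int. \<bar>of_int p + a + b * t\<bar> < \<delta>}
    \<le> ennreal (2 * \<delta> * (2 * R + 3 / \<bar>b\<bar>))"
proof -
  define L where "L = \<bar>b\<bar> * R + \<delta>"
  define P where "P = {\<lceil>- a - L\<rceil>..\<lfloor>- a + L\<rfloor>}"
  define J where "J = (\<lambda>p::int. {(- of_int p - a) / b - \<delta> / \<bar>b\<bar> .. (- of_int p - a) / b + \<delta> / \<bar>b\<bar>})"
  have L0: "0 \<le> L" using assms by (simp add: L_def)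
  have cardP: "real (card P) \<le> 2 * L + 1"
  proof -
    have "real_of_int (\<lfloor>- a + L\<rfloor> - \<lceil>- a - L\<rceil>) \<le> 2 * L"
      using of_int_floor_le[of "- a + L"] le_of_int_ceiling[of "- a - L"] by linarith
    then show ?thesis using L0 by (simp add: P_def)
  qed
  have sub: "{t \<in> {-R..R}. \<exists>p::int. \<bar>of_int p + a + b * t\<bar> < \<delta>} \<subseteq> (\<Union>p\<in>P. J p)"
  proof
    fix t assume "t \<in> {t \<in> {-R..R}. \<exists>p::int. \<bar>of_int p + a + b * t\<bar> < \<delta>}"
    then obtain p :: int where t: "\<bar>t\<bar> \<le> R" and p: "\<bar>of_int p + a + b * t\<bar> < \<delta>" by auto
    have "\<bar>b * t\<bar> \<le> \<bar>b\<bar> * R" using t by (simp add: abs_mult mult_left_mono)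
    then have "\<bar>of_int p + a\<bar> \<le> L" using p by (simp add: L_def)
    then have "p \<in> P" by (auto simp: P_def ceiling_le_iff le_floor_iff)
    moreover have "\<bar>t - (- of_int p - a) / b\<bar> \<le> \<delta> / \<bar>b\<bar>"
    proof -
      have "t - (- of_int p - a) / b = (of_int p + a + b * t) / b"
        using assms(1) by (simp add: field_simps)
      then show ?thesis using p by (simp add: abs_divide divide_right_mono)
    qed
    then have "t \<in> J p" unfolding J_def by (simp add: abs_le_iff) 
    ultimately show "t \<in> (\<Union>p\<in>P. J p)" by blast
  qed
  have "emeasure lborel {t \<in> {-R..R}. \<exists>p::int. \<bar>of_int p + a + b * t\<bar> < \<delta>}
      \<le> emeasure lborel (\<Union>p\<in>P. J p)"
    by (rule emeasure_mono[OF sub]) (auto simp: P_def J_def)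
  also have "\<dots> \<le> (\<Sum>p\<in>P. emeasure lborel (J p))"
    by (rule emeasure_subadditive_finite) (auto simp: P_def J_def)
  also have "\<dots> = (\<Sum>p\<in>P. ennreal (2 * \<delta> / \<bar>b\<bar>))"
  proof (rule sum.cong[OF refl])
    fix p show "emeasure lborel (J p) = ennreal (2 * \<delta> / \<bar>b\<bar>)"
      unfolding J_def using assms by (subst emeasure_lborel_Icc) auto
  qed
  also have "\<dots> = ennreal (real (card P) * (2 * \<delta> / \<bar>b\<bar>))"
    using assms by (simp add: ennreal_of_nat_eq_real_of_nat flip: ennreal_mult'')
  also have "\<dots> \<le> ennreal (2 * \<delta> * (2 * R + 3 / \<bar>b\<bar>))"
  proof (rule ennreal_leI)
    have "real (card P) * (2 * \<delta> / \<bar>b\<bar>) \<le> (2 * (\<bar>b\<bar> * R + 1) + 1) * (2 * \<delta> / \<bar>b\<bar>)"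
      using cardP assms by (intro mult_right_mono) (auto simp: L_def)
    also have "\<dots> = 2 * \<delta> * (2 * R + 3 / \<bar>b\<bar>)" using assms by (simp add: field_simps)
    finally show "real (card P) * (2 * \<delta> / \<bar>b\<bar>) \<le> 2 * \<delta> * (2 * R + 3 / \<bar>b\<bar>)" .
  qed
  finally show ?thesis .
qed

definition slab :: "'i set \<Rightarrow> real \<Rightarrow> real \<Rightarrow> ('i \<Rightarrow> real) \<Rightarrow> real \<Rightarrow> ('i \<Rightarrow> real) set" where
  "slab I R a b \<delta> = {x \<in> I \<rightarrow>\<^sub>E {-R..R}. \<exists>p::int. \<bar>of_int p + a + (\<Sum>i\<in>I. b i * x i)\<bar> < \<delta>}"

lemma slab_measurable:
  assumes "finite I"
  shows "slab I R a b \<delta> \<in> sets (Pi\<^sub>M I (\<lambda>_. lborel))"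
proof -
  have "slab I R a b \<delta> = (I \<rightarrow>\<^sub>E {-R..R}) \<inter>
      {x \<in> space (Pi\<^sub>M I (\<lambda>_. lborel)). \<exists>p::int. \<bar>of_int p + a + (\<Sum>i\<in>I. b i * x i)\<bar> < \<delta>}"
    by (auto simp: slab_def space_PiM PiE_def)
  moreover have "(I \<rightarrow>\<^sub>E {-R..R}) \<in> sets (Pi\<^sub>M I (\<lambda>_. lborel))"
    using assms by (intro sets_PiM_I_finite) auto
  moreover have "{x \<in> space (Pi\<^sub>M I (\<lambda>_. lborel)). \<exists>p::int. \<bar>of_int p + a + (\<Sum>i\<in>I. b i * x i)\<bar> < \<delta>}
      \<in> sets (Pi\<^sub>M I (\<lambda>_. lborel))"
    by measurable
  ultimately show ?thesis by auto
qed

lemma emeasure_slab_le: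
  assumes I: "finite I" "j \<in> I" and "b j \<noteq> 0" "0 \<le> R" "0 \<le> \<delta>" "\<delta> \<le> 1"
  shows "emeasure (Pi\<^sub>M I (\<lambda>_. lborel)) (slab I R a b \<delta>)
    \<le> ennreal ((2 * R) ^ (card I - 1) * (2 * \<delta> * (2 * R + 3 / \<bar>b j\<bar>)))"
proof -
  interpret product_sigma_finite "\<lambda>_::'a. lborel :: real measure" by unfold_locales
  define K where "K = I - {j}"
  have IK: "I = insert j K" "j \<notin> K" "finite K" using I by (auto simp: K_def)
  define m where "m = 2 * \<delta> * (2 * R + 3 / \<bar>b j\<bar>)"
  have m0: "0 \<le> m" using assms by (simp add: m_def)
  have S: "slab I R a b \<delta> \<in> sets (Pi\<^sub>M (insert j K) (\<lambda>_. lborel))"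
    using slab_measurable[OF I(1)] by (simp add: IK(1))
  \<comment> \<open>The indicator on the right records that slices over points outside the box are
    empty, so that the outer integral stays finite.\<close>
  have slice: "(\<integral>\<^sup>+y. indicator (slab I R a b \<delta>) (x(j := y)) \<partial>lborel)
      \<le> ennreal m * indicator (K \<rightarrow>\<^sub>E {-R..R}) x" if x: "x \<in> space (Pi\<^sub>M K (\<lambda>_. lborel :: real measure))" for x
  proof -
    define T where "T = {t \<in> {-R..R}. \<exists>p::int. \<bar>of_int p + (a + (\<Sum>i\<in>K. b i * x i)) + b j * t\<bar> < \<delta>}"
    have sm: "(\<Sum>i\<in>I. b i * (x(j := y)) i) = b j * y + (\<Sum>i\<in>K. b i * x i)" for y
    proof -
      have "(\<Sum>i\<in>K. b i * (x(j := y)) i) = (\<Sum>i\<in>K. b i * x i)"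
        using IK by (intro sum.cong) auto
      then show ?thesis using IK by simp
    qed
    have xe: "x \<in> extensional K" using x by (auto simp: space_PiM PiE_def)
    have "indicator (slab I R a b \<delta>) (x(j := y))
        = (indicator T y * indicator (K \<rightarrow>\<^sub>E {-R..R}) x :: ennreal)" for y
    proof -
      have "x(j := y) \<in> I \<rightarrow>\<^sub>E {-R..R} \<longleftrightarrow> y \<in> {-R..R} \<and> x \<in> K \<rightarrow>\<^sub>E {-R..R}"
        using xe IK(2) unfolding IK(1) by (auto simp: PiE_def Pi_def extensional_def split: if_splits)
      moreover have "\<bar>of_int p + a + (\<Sum>i\<in>I. b i * (x(j := y)) i)\<bar>
          = \<bar>of_int p + (a + (\<Sum>i\<in>K. b i * x i)) + b j * y\<bar>" for p :: int
        unfolding sm by (simp add: algebra_simps)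
      ultimately show ?thesis
        unfolding slab_def T_def indicator_def by auto
    qed
    moreover have "T \<in> sets lborel" unfolding T_def by measurable
    moreover have "emeasure lborel T \<le> ennreal m"
      unfolding T_def m_def by (rule emeasure_affine_near_integer_interval) (use assms in auto)
    ultimately show ?thesis
      by (simp add: nn_integral_multc mult_right_mono)
  qed
  have "emeasure (Pi\<^sub>M I (\<lambda>_. lborel)) (slab I R a b \<delta>)
      = (\<integral>\<^sup>+x. indicator (slab I R a b \<delta>) x \<partial>Pi\<^sub>M (insert j K) (\<lambda>_. lborel))"
    using S by (simp add: IK(1))
  also have "\<dots> = (\<integral>\<^sup>+x. (\<integral>\<^sup>+y. indicator (slab I R a b \<delta>) (x(j := y)) \<partial>lborel) \<partial>Pi\<^sub>M K (\<lambda>_. lborel))"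
    using S IK by (subst product_nn_integral_insert) auto
  also have "\<dots> \<le> (\<integral>\<^sup>+x. ennreal m * indicator (K \<rightarrow>\<^sub>E {-R..R}) x \<partial>Pi\<^sub>M K (\<lambda>_. lborel))"
    by (intro nn_integral_mono slice)
  also have "\<dots> = ennreal m * emeasure (Pi\<^sub>M K (\<lambda>_. lborel)) (K \<rightarrow>\<^sub>E {-R..R})"
    using IK by (subst nn_integral_cmult_indicator) (auto intro!: sets_PiM_I_finite)
  also have "emeasure (Pi\<^sub>M K (\<lambda>_. lborel)) (K \<rightarrow>\<^sub>E {-R..R}) = ennreal ((2 * R) ^ card K)"
    using IK assms(4) by (subst emeasure_PiM) (auto simp: ennreal_power)
  also have "ennreal m * ennreal ((2 * R) ^ card K) = ennreal ((2 * R) ^ (card I - 1) * m)"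
    using IK m0 assms(4) by (simp add: ennreal_mult mult.commute)
  finally show ?thesis unfolding m_def .
qed

section \<open>Separated denominators\<close>

text \<open>Dividing by \<open>d\<close> and rounding down is injective on \<open>F\<close>, because
  members differ by at least \<open>d\<close>, and its values are at least 1. This compares the sum
  with \<open>(1 / d) ^ n\<close> times the zeta value at \<open>n\<close>.\<close>

lemma sum_inverse_power_separated_le:
  fixes F :: "nat set" and d :: real
  assumes "finite F" "2 \<le> n" "0 < d"
    and ge: "\<And>k. k \<in> F \<Longrightarrow> d \<le> real k"
    and gap: "\<And>k l. k \<in> F \<Longrightarrow> l \<in> F \<Longrightarrow> l < k \<Longrightarrow> d \<le> real (k - l)"
  shows "(\<Sum>k\<in>F. 1 / real k ^ n) \<le> (1 / d) ^ n * (\<Sum>m. inverse (real m ^ n))"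
proof -
  define f where "f = (\<lambda>k. nat \<lfloor>real k / d\<rfloor>)"
  have f1: "1 \<le> f k" and fk: "real (f k) * d \<le> real k" if "k \<in> F" for k
  proof -
    have "1 \<le> real k / d" using ge[OF that] assms(3) by simp
    then have "1 \<le> \<lfloor>real k / d\<rfloor>" by (simp add: le_floor_iff)
    then show "1 \<le> f k" unfolding f_def by linarith
    then have "real (f k) \<le> real k / d" using \<open>1 \<le> \<lfloor>real k / d\<rfloor>\<close> by (simp add: f_def)
    then show "real (f k) * d \<le> real k" using assms(3) by (simp add: field_simps)
  qed
  have neq: "f k \<noteq> f l" if "k \<in> F" "l \<in> F" "l < k" for k l
  proof -
    have "real l + d \<le> real k" using gap[OF that] that by (simp add: of_nat_diff)
    then have "(real l + d) / d \<le> real k / d" using assms(3) by (intro divide_right_mono) auto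
    then have "real l / d + 1 \<le> real k / d" using assms(3) by (simp add: add_divide_distrib)
    then have "\<lfloor>real l / d\<rfloor> + 1 \<le> \<lfloor>real k / d\<rfloor>"
      by (metis floor_add_int floor_mono of_int_1)
    moreover have "0 \<le> \<lfloor>real l / d\<rfloor>" using assms(3) by simp
    ultimately show ?thesis unfolding f_def by linarith
  qed
  have inj: "inj_on f F"
    by (rule inj_onI) (metis neq linorder_neqE_nat)
  have "(\<Sum>k\<in>F. 1 / real k ^ n) \<le> (\<Sum>k\<in>F. (1 / d) ^ n * inverse (real (f k) ^ n))"
  proof (rule sum_mono)
    fix k assume k: "k \<in> F"
    have "(real (f k) * d) ^ n \<le> real k ^ n"
      using fk[OF k] assms(3) by (intro power_mono) auto
    moreover have "0 < (real (f k) * d) ^ n" using f1[OF k] assms(3) by simp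
    ultimately have "1 / real k ^ n \<le> 1 / (real (f k) * d) ^ n"
      by (intro divide_left_mono mult_pos_pos) linarith+
    then show "1 / real k ^ n \<le> (1 / d) ^ n * inverse (real (f k) ^ n)"
      by (simp add: power_mult_distrib power_divide field_simps)
  qed
  also have "\<dots> = (1 / d) ^ n * (\<Sum>m\<in>f ` F. inverse (real m ^ n))"
    by (simp add: sum.reindex[OF inj] sum_distrib_left)
  \<comment> \<open>The index 0 adds nothing to the series, as \<open>inverse 0 = 0\<close>.\<close>
  also have "\<dots> \<le> (1 / d) ^ n * (\<Sum>m. inverse (real m ^ n))"
    using assms by (intro mult_left_mono sum_le_suminf inverse_power_summable) auto
  finally show ?thesis .
qed

text \<open>Group the \<open>k\<close> by the dyadic size of \<open>\<delta> k\<close>. If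
  \<open>\<delta>\<close> is small at \<open>k\<close> and \<open>l\<close>, it is small at
  \<open>k - l\<close>, and \<open>low\<close> then forces \<open>k - l\<close> to be large; so each
  level is a separated set. Since \<open>u < n\<close>, the bounds for the levels form a geometric
  series with ratio below 1.\<close>

lemma summable_inverse_power_divide_badly_approximable:
  fixes \<delta> :: "nat \<Rightarrow> real" and u c :: real
  assumes n: "2 \<le> n" and u: "0 < u" "u < real n" and c: "0 < c"
    and low: "\<And>m. 1 \<le> m \<Longrightarrow> c * real m powr (-u) \<le> \<delta> m"
    and up: "\<And>m. \<delta> m \<le> 1"
    and diff: "\<And>k l. l < k \<Longrightarrow> \<delta> (k - l) \<le> \<delta> k + \<delta> l"
  shows "summable (\<lambda>k. 1 / (real k ^ n * \<delta> k))"
proof -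
  define Z where "Z = (\<Sum>m. inverse (real m ^ n))"
  \<comment> \<open>\<open>d j\<close> solves \<open>c * d powr (-u) = 2 / 2 ^ j\<close>, so no
    positive \<open>m\<close> below it has \<open>\<delta> m < 2 / 2 ^ j\<close>. The level
    \<open>e k\<close> is chosen so that \<open>1 / \<delta> k\<close> lies between
    \<open>2 ^ e k\<close> and twice that.\<close>
  define d where "d = (\<lambda>j::nat. (c * 2 ^ j / 2) powr (1 / u))"
  define e where "e = (\<lambda>k. nat \<lfloor>log 2 (1 / \<delta> k)\<rfloor>)"
  \<comment> \<open>\<open>r\<close> and \<open>C\<close> are read off from the bound
    \<open>2 * 2 ^ j * ((1 / d j) ^ n * Z)\<close> for level \<open>j\<close>.\<close>
  define r where "r = 2 powr (1 - real n / u)"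
  define C where "C = 2 * (c / 2) powr (- (real n / u)) * Z"
  have Z0: "0 \<le> Z" unfolding Z_def using n by (intro suminf_nonneg inverse_power_summable) auto
  have pos: "0 < \<delta> m" if "1 \<le> m" for m
    using low[OF that] c that by (smt (verit) mult_pos_pos powr_gt_zero of_nat_0_less_iff less_le_trans zero_less_one of_nat_less_iff not_one_le_zero gr0I)
  have e: "2 ^ e k \<le> 1 / \<delta> k" "1 / \<delta> k \<le> 2 * 2 ^ e k" if "1 \<le> k" for k
  proof -
    have L: "0 \<le> log 2 (1 / \<delta> k)" using pos[OF that] up[of k] by simp
    then have ek: "real (e k) = of_int \<lfloor>log 2 (1 / \<delta> k)\<rfloor>" by (simp add: e_def)
    have eq: "1 / \<delta> k = 2 powr (log 2 (1 / \<delta> k))" using pos[OF that] by simp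
    have "2 powr real (e k) \<le> 2 powr (log 2 (1 / \<delta> k))" unfolding ek by simp
    then show "2 ^ e k \<le> 1 / \<delta> k" using eq by (simp add: powr_realpow)
    have "2 powr (log 2 (1 / \<delta> k)) \<le> 2 powr (real (e k) + 1)"
      unfolding ek using L by (intro powr_mono) linarith+
    then show "1 / \<delta> k \<le> 2 * 2 ^ e k" using eq by (simp add: powr_add powr_realpow)
  qed
  have sep: "d j \<le> real m" if "1 \<le> m" "\<delta> m \<le> 2 / 2 ^ j" for m j
  proof -
    have "c * real m powr (-u) \<le> 2 / 2 ^ j" using low[OF that(1)] that(2) by linarith
    then have "c * 2 ^ j / 2 \<le> real m powr u"
      using that(1) by (simp add: powr_minus field_simps)
    then have "d j \<le> (real m powr u) powr (1 / u)"
      unfolding d_def using c u by (intro powr_mono2) auto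
    also have "\<dots> = real m" using u that by (simp add: powr_powr)
    finally show ?thesis .
  qed
  have d0: "0 < d j" for j using c by (simp add: d_def)
  have dn: "2 * 2 ^ j * ((1 / d j) ^ n * Z) = C * r ^ j" for j
  proof -
    have "(1 / d j) ^ n = (d j powr real n) powr (-1)"
      using d0[of j] by (simp add: powr_realpow powr_minus_divide power_divide)
    also have "\<dots> = ((c / 2) * 2 ^ j) powr (- (real n / u))"
      unfolding d_def powr_powr by simp
    also have "\<dots> = (c / 2) powr (- (real n / u)) * (2 ^ j) powr (- (real n / u))"
      using c by (intro powr_mult) 
    also have "(2 ^ j :: real) powr (- (real n / u)) = (2 powr (- (real n / u))) ^ j"
      by (simp add: powr_realpow[symmetric] powr_powr mult.commute)
    finally have "(1 / d j) ^ n = (c / 2) powr (- (real n / u)) * (2 powr (- (real n / u))) ^ j" .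
    moreover have "r = 2 * 2 powr (- (real n / u))" by (simp add: r_def powr_diff powr_minus_divide)
    ultimately show ?thesis by (simp add: C_def power_mult_distrib)
  qed
  have "r < 2 powr 0" unfolding r_def using u by (intro powr_less_mono) auto
  then have r: "0 < r" "r < 1" by (auto simp: r_def)
  have C0: "0 \<le> C" using Z0 by (simp add: C_def)
  show ?thesis
  proof (rule summableI_nonneg_bounded)
    show "0 \<le> 1 / (real k ^ n * \<delta> k)" for k
      using pos[of k] n by (cases "k = 0") (auto simp: power_0_left)
  next
    fix N :: nat
    define F where "F = {1..<N}"
    define J where "J = Max (e ` F \<union> {0})"
    \<comment> \<open>The term at \<open>k = 0\<close> is \<open>1 / 0 = 0\<close>.\<close>
    have "(\<Sum>k<N. 1 / (real k ^ n * \<delta> k)) = (\<Sum>k\<in>F. 1 / (real k ^ n * \<delta> k))"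
      unfolding F_def using n by (intro sum.mono_neutral_right) auto
    also have "\<dots> = (\<Sum>j\<le>J. \<Sum>k\<in>{k\<in>F. e k = j}. 1 / (real k ^ n * \<delta> k))"
      by (rule sum.group[symmetric]) (auto simp: F_def J_def)
    also have "\<dots> \<le> (\<Sum>j\<le>J. C * r ^ j)"
    proof (rule sum_mono)
      fix j
      define G where "G = {k\<in>F. e k = j}"
      have G1: "1 \<le> k" if "k \<in> G" for k using that by (auto simp: G_def F_def)
      have Gd: "\<delta> k \<le> 1 / 2 ^ j" if "k \<in> G" for k
        using e(1)[OF G1[OF that]] that pos[OF G1[OF that]] by (simp add: G_def field_simps)
      have "(\<Sum>k\<in>G. 1 / (real k ^ n * \<delta> k)) \<le> (\<Sum>k\<in>G. 2 * 2 ^ j * (1 / real k ^ n))"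
      proof (rule sum_mono)
        fix k assume k: "k \<in> G"
        have "1 / real k ^ n * (1 / \<delta> k) \<le> 1 / real k ^ n * (2 * 2 ^ j)"
          using e(2)[OF G1[OF k]] k by (intro mult_left_mono) (auto simp: G_def)
        then show "1 / (real k ^ n * \<delta> k) \<le> 2 * 2 ^ j * (1 / real k ^ n)" by (simp add: mult_ac)
      qed
      also have "\<dots> = 2 * 2 ^ j * (\<Sum>k\<in>G. 1 / real k ^ n)" by (simp add: sum_distrib_left)
      also have "\<dots> \<le> 2 * 2 ^ j * ((1 / d j) ^ n * Z)"
        unfolding Z_def
      proof (intro mult_left_mono sum_inverse_power_separated_le n d0)
        show "finite G" by (simp add: G_def F_def)
        show "d j \<le> real k" if "k \<in> G" for k
        proof (rule sep[OF G1[OF that]])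
          have "1 / 2 ^ j \<le> 2 / (2 ^ j :: real)" by (simp add: divide_right_mono)
          then show "\<delta> k \<le> 2 / 2 ^ j" using Gd[OF that] by linarith
        qed
        \<comment> \<open>Two members of the level have distances at most \<open>1 / 2 ^ j\<close>
          each, so their difference reaches \<open>2 / 2 ^ j\<close>; hence the 2 in
          \<open>sep\<close>.\<close>
        show "d j \<le> real (k - l)" if "k \<in> G" "l \<in> G" "l < k" for k l
        proof (rule sep)
          show "\<delta> (k - l) \<le> 2 / 2 ^ j"
            using diff[OF that(3)] Gd[OF that(1)] Gd[OF that(2)] by simp
        qed (use that in auto)
      qed auto
      finally show "(\<Sum>k\<in>{k\<in>F. e k = j}. 1 / (real k ^ n * \<delta> k)) \<le> C * r ^ j"
        unfolding dn G_def .
    qed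
    also have "\<dots> \<le> (\<Sum>j. C * r ^ j)"
      using r C0 by (intro sum_le_suminf summable_mult summable_geometric) auto
    finally show "(\<Sum>k<N. 1 / (real k ^ n * \<delta> k)) \<le> (\<Sum>j. C * r ^ j)" .
  qed
qed

section \<open>Pointwise decay of a monotone function from a convergent series\<close>

text \<open>A discrete form of integrating \<open>x ^ m\<close>: the increment from
  \<open>k ^ Suc m\<close> to \<open>Suc k ^ Suc m\<close> is at most
  \<open>Suc m * Suc k ^ m\<close>, and the increments telescope.\<close>

lemma power_le_mult_sum_power:
  "real k ^ Suc m \<le> real (Suc m) * (\<Sum>i<k. real (Suc i) ^ m)"
proof (induction k)
  case (Suc k)
  have "real (Suc k) ^ Suc m \<le> real k ^ Suc m + real (Suc m) * real (Suc k) ^ m"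
  proof (induction m)
    case (Suc m)
    have "real (Suc k) ^ Suc (Suc m) = real k * real (Suc k) ^ Suc m + real (Suc k) ^ Suc m"
      by (simp add: algebra_simps)
    also have "real k * real (Suc k) ^ Suc m
        \<le> real k * (real k ^ Suc m + real (Suc m) * real (Suc k) ^ m)"
      by (intro mult_left_mono Suc) simp
    also have "\<dots> + real (Suc k) ^ Suc m \<le>
        real k ^ Suc (Suc m) + real (Suc (Suc m)) * real (Suc k) ^ Suc m"
    proof -
      have "real k * (real (Suc m) * real (Suc k) ^ m) \<le> real (Suc k) * (real (Suc m) * real (Suc k) ^ m)"
        by (intro mult_right_mono) auto
      then show ?thesis by (simp add: algebra_simps)
    qed
    finally show ?case by simp
  qed simp
  with Suc show ?case by (simp add: algebra_simps)
qed simp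

text \<open>By monotonicity the first \<open>k\<close> terms of the series sum to at least
  \<open>\<psi> k\<close> times the sum of the powers up to \<open>k ^ m\<close>, which has order
  \<open>k ^ Suc m\<close>.\<close>

lemma antimono_summable_bound:
  fixes \<psi> :: "nat \<Rightarrow> real"
  assumes anti: "antimono_on {1..} \<psi>" and nonneg: "\<And>k. 1 \<le> k \<Longrightarrow> 0 \<le> \<psi> k"
    and "summable (\<lambda>k. real (Suc k) ^ m * \<psi> (Suc k))"
  obtains C where "0 < C" "\<And>k. 1 \<le> k \<Longrightarrow> real k ^ Suc m * \<psi> k \<le> C"
proof -
  define S where "S = (\<Sum>k. real (Suc k) ^ m * \<psi> (Suc k))"
  have S0: "0 \<le> S" unfolding S_def using assms(3) nonneg by (intro suminf_nonneg) auto
  \<comment> \<open>The added 1 makes the constant positive even when \<open>S = 0\<close>.\<close>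
  have "real k ^ Suc m * \<psi> k \<le> real (Suc m) * S + 1" if k: "1 \<le> k" for k
  proof -
    have "real k ^ Suc m * \<psi> k \<le> real (Suc m) * (\<Sum>i<k. real (Suc i) ^ m) * \<psi> k"
      using nonneg[OF k] power_le_mult_sum_power by (intro mult_right_mono)
    also have "\<dots> = real (Suc m) * (\<Sum>i<k. real (Suc i) ^ m * \<psi> k)"
      by (simp add: sum_distrib_right)
    also have "\<dots> \<le> real (Suc m) * (\<Sum>i<k. real (Suc i) ^ m * \<psi> (Suc i))"
      using anti by (intro mult_left_mono sum_mono) (auto simp: monotone_on_def)
    also have "\<dots> \<le> real (Suc m) * S"
      unfolding S_def using assms(3) nonneg by (intro mult_left_mono sum_le_suminf) auto
    finally show ?thesis by simp
  qed
  moreover have "0 < real (Suc m) * S + 1" using S0 by (simp add: add_nonneg_pos)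
  ultimately show ?thesis using that by blast
qed

section \<open>Distance to the integers\<close>

definition int_dist :: "real \<Rightarrow> real" where
  "int_dist t = \<bar>t - of_int (round t)\<bar>"

lemma int_dist_nonneg: "0 \<le> int_dist t"
  by (simp add: int_dist_def)

lemma int_dist_le: "int_dist t \<le> \<bar>t - of_int p\<bar>"
  unfolding int_dist_def by (rule round_diff_minimal)

lemma int_dist_le_half: "int_dist t \<le> 1 / 2"
  using of_int_round_abs_le[of t] by (simp add: int_dist_def abs_minus_commute)

lemma int_dist_diff: "int_dist (s - t) \<le> int_dist s + int_dist t"
  using int_dist_le[of "s - t" "round s - round t"] by (simp add: int_dist_def)

lemma int_dist_minus: "int_dist (- t) = int_dist t"
  using int_dist_le[of "- t" "- round t"] int_dist_le[of t "- round (- t)"]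
  by (simp add: int_dist_def abs_minus_commute)

text \<open>Nearest integers may be chosen coordinate by coordinate, so for \<open>n \<ge> 1\<close>
  this is the max-norm distance from \<open>m A\<close> to the integer vectors.\<close>

definition column_dist :: "nat \<Rightarrow> (nat \<Rightarrow> real) \<Rightarrow> nat \<Rightarrow> real" where
  "column_dist n A m = (MAX i\<in>{..<n}. int_dist (real m * A i))"

lemma int_dist_le_column_dist: "i < n \<Longrightarrow> int_dist (real m * A i) \<le> column_dist n A m"
  unfolding column_dist_def by (rule Max_ge) auto

lemma column_dist_attained:
  assumes "1 \<le> n"
  obtains i where "i < n" "column_dist n A m = int_dist (real m * A i)"
proof -
  have "column_dist n A m \<in> (\<lambda>i. int_dist (real m * A i)) ` {..<n}"
    unfolding column_dist_def using assms by (intro Max_in) (auto simp: lessThan_empty_iff)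
  then show ?thesis using that by auto
qed

lemma column_dist_le_1: "1 \<le> n \<Longrightarrow> column_dist n A m \<le> 1"
  by (rule column_dist_attained[of n A m], assumption)
     (use int_dist_le_half in \<open>force intro: order_trans[of _ "1/2"]\<close>)

text \<open>The triangle inequality modulo integer vectors; it turns lower bounds for the distance
  into gaps between denominators.\<close>

lemma column_dist_diff:
  assumes "1 \<le> n" "l \<le> k"
  shows "column_dist n A (k - l) \<le> column_dist n A k + column_dist n A l"
proof -
  obtain i where i: "i < n" "column_dist n A (k - l) = int_dist (real (k - l) * A i)"
    using column_dist_attained[OF assms(1)] by blast
  have "int_dist (real (k - l) * A i) \<le> int_dist (real k * A i) + int_dist (real l * A i)"
    using int_dist_diff[of "real k * A i" "real l * A i"] assms(2)
    by (simp add: of_nat_diff left_diff_distrib)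
  then show ?thesis
    using i int_dist_le_column_dist[OF i(1), of k A] int_dist_le_column_dist[OF i(1), of l A] by linarith
qed

lemma column_dist_mult_zero:
  assumes "1 \<le> n" "column_dist n A m = 0"
  shows "column_dist n A (l * m) = 0"
proof -
  obtain i where i: "i < n" "column_dist n A (l * m) = int_dist (real (l * m) * A i)"
    using column_dist_attained[OF assms(1)] by blast
  have "int_dist (real m * A i) = 0"
    using int_dist_le_column_dist[OF i(1), of m A] assms(2) int_dist_nonneg[of "real m * A i"] by simp
  then have "real m * A i = of_int (round (real m * A i))" by (simp add: int_dist_def)
  then have "real (l * m) * A i = of_int (int l * round (real m * A i))"
    by (metis mult.assoc of_int_mult of_int_of_nat_eq of_nat_mult)
  then have "int_dist (real (l * m) * A i) = 0" unfolding int_dist_def by (simp del: of_int_mult)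
  then show ?thesis using i by simp
qed

text \<open>The hypothesis gives some \<open>u < n\<close> for which only finitely many
  \<open>m\<close> have distance below \<open>m powr (-u)\<close>. Each of these still has positive
  distance, so lowering the constant to a finite minimum covers them too.\<close>

lemma column_dist_lower_bound:
  assumes n: "1 \<le> n" and A: "A \<in> column_matrices n" and W: "A \<notin> W_minus_set (real n) n"
  obtains u c where "0 < u" "u < real n" "0 < c"
    "\<And>m. 1 \<le> m \<Longrightarrow> c * real m powr (-u) \<le> column_dist n A m"
proof -
  obtain u where u: "0 < u" "u < real n" "A \<notin> W_set u n"
    using W by (auto simp: W_minus_set_def)
  define B where "B = {m::nat. 1 \<le> m \<and> column_dist n A m < real m powr (-u)}"
  have "int ` B \<subseteq> {q :: int. \<exists>p \<in> {..<n} \<rightarrow>\<^sub>E (UNIV :: int set).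
       (MAX i\<in>{..<n}. \<bar>of_int (p i) + A i * of_int q\<bar>) < \<bar>of_int q\<bar> powr (- u)}"
  proof safe
    fix m assume m: "m \<in> B"
    define p where "p = (\<lambda>i\<in>{..<n}. - round (real m * A i))"
    have "(MAX i\<in>{..<n}. \<bar>of_int (p i) + A i * of_int (int m)\<bar>) = column_dist n A m"
      unfolding column_dist_def
      by (intro arg_cong[where f = Max] image_cong refl) (auto simp: p_def int_dist_def mult.commute)
    then show "\<exists>p \<in> {..<n} \<rightarrow>\<^sub>E (UNIV :: int set).
       (MAX i\<in>{..<n}. \<bar>of_int (p i) + A i * of_int (int m)\<bar>) < \<bar>of_int (int m)\<bar> powr (- u)"
      using m by (intro bexI[of _ p]) (auto simp: B_def p_def)
  qed
  moreover have "finite {q :: int. \<exists>p \<in> {..<n} \<rightarrow>\<^sub>E (UNIV :: int set).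
       (MAX i\<in>{..<n}. \<bar>of_int (p i) + A i * of_int q\<bar>) < \<bar>of_int q\<bar> powr (- u)}"
    using u(3) A by (auto simp: W_set_def)
  ultimately have "finite (int ` B)" by (rule finite_subset)
  then have finB: "finite B" by (rule finite_imageD) auto
  \<comment> \<open>A zero distance at \<open>m\<close> would put all positive multiples of
    \<open>m\<close> into the finite set \<open>B\<close>.\<close>
  have pos: "0 < column_dist n A m" if m: "1 \<le> m" for m
  proof (rule ccontr)
    assume "\<not> 0 < column_dist n A m"
    moreover have "0 \<le> column_dist n A m"
      using int_dist_nonneg int_dist_le_column_dist[of 0 n m A] n by (meson order_trans less_le_trans zero_less_one)
    ultimately have "column_dist n A m = 0" by simp
    then have "column_dist n A (Suc l * m) = 0" for l by (rule column_dist_mult_zero[OF n])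
    then have "Suc l * m \<in> B" for l
      unfolding B_def using m by (auto simp del: mult_Suc)
    then have "range (\<lambda>l. Suc l * m) \<subseteq> B" by blast
    moreover have "inj (\<lambda>l. Suc l * m)" using m by (intro injI) (simp del: mult_Suc)
    ultimately show False using finB finite_subset range_inj_infinite by blast
  qed
  \<comment> \<open>The entry 1 serves every \<open>m\<close> outside \<open>B\<close> and keeps the
    set nonempty.\<close>
  define c where "c = Min (insert 1 ((\<lambda>m. column_dist n A m * real m powr u) ` B))"
  have "0 < c" unfolding c_def using finB pos by (subst Min_gr_iff) (auto simp: B_def)
  moreover have "c * real m powr (-u) \<le> column_dist n A m" if m: "1 \<le> m" for m
  proof (cases "m \<in> B")
    case True
    then have "c \<le> column_dist n A m * real m powr u" unfolding c_def using finB by (intro Min_le) auto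
    then show ?thesis using m by (simp add: powr_minus field_simps)
  next
    case False
    have "c \<le> 1" unfolding c_def using finB by (intro Min_le) auto
    then have "c * real m powr (-u) \<le> 1 * real m powr (-u)" by (intro mult_right_mono) auto
    also have "\<dots> \<le> column_dist n A m" using False m by (simp add: B_def)
    finally show ?thesis .
  qed
  ultimately show ?thesis using that u by blast
qed

text \<open>Otherwise the distance at \<open>k\<close> is at least \<open>c * k powr (-u)\<close>
  with \<open>u < 1\<close>. Dirichlet gives for every \<open>N\<close> some
  \<open>k \<le> N\<close> with distance below \<open>1 / N\<close>, hence
  \<open>c < N powr (u - 1)\<close>, which tends to 0.\<close>

lemma W_minus_set_one:
  assumes A: "A \<in> column_matrices 1"
  shows "A \<in> W_minus_set 1 1"
proof (rule ccontr)
  assume "A \<notin> W_minus_set 1 1"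
  then obtain u c where u: "0 < u" "u < 1" and c: "0 < c"
    and low: "\<And>m. 1 \<le> m \<Longrightarrow> c * real m powr (-u) \<le> column_dist 1 A m"
    using column_dist_lower_bound[of 1 A] A by auto
  have bound: "c < real N powr (u - 1)" if N: "1 \<le> N" for N :: nat
  proof -
    obtain h k where k: "0 < k" "k \<le> int N" "\<bar>of_int k * A 0 - of_int h\<bar> < 1 / N"
      by (rule Dirichlet_approx[of N "A 0"]) (use N in auto)
    have "column_dist 1 A (nat k) = int_dist (of_int k * A 0)"
      using k by (simp add: column_dist_def lessThan_Suc)
    also have "\<dots> < 1 / N" using int_dist_le[of "of_int k * A 0" h] k by linarith
    finally have "column_dist 1 A (nat k) < 1 / N" .
    moreover have "c * real N powr (-u) \<le> c * real (nat k) powr (-u)"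
      using c u k by (intro mult_left_mono powr_mono2') auto
    ultimately have "c * real N powr (-u) < 1 / N" using low[of "nat k"] k by linarith
    then have "c < real N powr u / real N" using N by (simp add: powr_minus field_simps)
    then show ?thesis using N by (simp add: powr_diff)
  qed
  have "((\<lambda>N. real N powr (u - 1)) \<longlongrightarrow> 0) sequentially"
    using u by (intro tendsto_neg_powr filterlim_real_sequentially) auto
  then have "\<forall>\<^sub>F N in sequentially. real N powr (u - 1) < c" using c by (rule order_tendstoD)
  then have "\<forall>\<^sub>F N::nat in sequentially. False"
    using eventually_ge_at_top[of 1] by eventually_elim (use bound in force)
  then show False by simp
qed

section \<open>Borel-Cantelli arguments\<close>

text \<open>Borel-Cantelli for the shifted events \<open>E (k + K)\<close>; finitely many initial
  events do not affect an eventual statement.\<close>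

lemma borel_cantelli_AE_le:
  assumes meas: "\<And>k. E k \<in> sets M"
    and le: "\<And>k. K \<le> k \<Longrightarrow> emeasure M (E k) \<le> ennreal (f k)"
    and nonneg: "\<And>k. K \<le> k \<Longrightarrow> 0 \<le> f k" and sum: "summable f"
  shows "AE x in M. eventually (\<lambda>k. x \<notin> E k) sequentially"
proof -
  have "AE x in M. eventually (\<lambda>k. x \<in> space M - E (k + K)) sequentially"
  proof (rule borel_cantelli_AE1)
    show "emeasure M (E (k + K)) < \<infinity>" for k
      using le[of "k + K"] by (auto intro: le_less_trans)
    have m: "norm (measure M (E (k + K))) \<le> f (k + K)" for k
      unfolding measure_def real_norm_def abs_of_nonneg[OF enn2real_nonneg]
      using le[of "k + K"] nonneg[of "k + K"] by (intro enn2real_leI) auto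
    have "summable (\<lambda>k. f (k + K))" using sum by (rule summable_ignore_initial_segment)
    then show "summable (\<lambda>k. measure M (E (k + K)))"
      by (rule summable_comparison_test'[of _ 0]) (rule m)
  qed (rule meas)
  then show ?thesis
  proof eventually_elim
    fix x assume "\<forall>\<^sub>F k in sequentially. x \<in> space M - E (k + K)"
    then have "\<forall>\<^sub>F k in sequentially. x \<notin> E (k + K)" by (rule eventually_mono) auto
    then show "\<forall>\<^sub>F k in sequentially. x \<notin> E k" by (rule eventually_sequentially_seg[THEN iffD1])
  qed
qed

section \<open>Counting integer vectors of a given height\<close>

definition height :: "nat \<Rightarrow> (nat \<Rightarrow> int) \<Rightarrow> nat" where
  "height n q = (MAX i\<in>{1..n}. nat \<bar>q i\<bar>)"

lemma abs_le_height: "i \<in> {1..n} \<Longrightarrow> nat \<bar>q i\<bar> \<le> height n q"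
  unfolding height_def by (rule Max_ge) auto

text \<open>The maximum is attained, so the vector lies on a face of the cube of half side
  \<open>k\<close>. Passing to faces saves one power of \<open>k\<close> in the count.\<close>

lemma height_eq_subset:
  assumes "1 \<le> n"
  shows "{q \<in> {1..n} \<rightarrow>\<^sub>E (UNIV :: int set). height n q = k}
    \<subseteq> (\<Union>i\<in>{1..n}. \<Union>s\<in>{int k, - int k}.
        Pi\<^sub>E {1..n} (\<lambda>j. if j = i then {s} else {- int k..int k}))"
proof
  fix q assume q: "q \<in> {q \<in> {1..n} \<rightarrow>\<^sub>E (UNIV :: int set). height n q = k}"
  have "height n q \<in> (\<lambda>i. nat \<bar>q i\<bar>) ` {1..n}"
    unfolding height_def using assms by (intro Max_in) auto
  then obtain i where i: "i \<in> {1..n}" "nat \<bar>q i\<bar> = k" using q by auto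
  have "\<bar>q j\<bar> \<le> int k" if "j \<in> {1..n}" for j using abs_le_height[OF that, of q] q by auto
  then have "q j \<in> {- int k..int k}" if "j \<in> {1..n}" for j using that by (simp add: abs_le_iff minus_le_iff)
  moreover have "q i \<in> {int k, - int k}" using i by auto
  ultimately have "q \<in> Pi\<^sub>E {1..n} (\<lambda>j. if j = i then {q i} else {- int k..int k})"
    using q by (auto simp: PiE_iff)
  then show "q \<in> (\<Union>i\<in>{1..n}. \<Union>s\<in>{int k, - int k}.
        Pi\<^sub>E {1..n} (\<lambda>j. if j = i then {s} else {- int k..int k}))"
    using i(1) \<open>q i \<in> {int k, - int k}\<close> by blast
qed

lemma finite_height_eq:
  assumes "1 \<le> n"
  shows "finite {q \<in> {1..n} \<rightarrow>\<^sub>E (UNIV :: int set). height n q = k}"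
  by (rule finite_subset[OF height_eq_subset[OF assms]]) (auto intro!: finite_PiE)

lemma card_height_eq_le:
  assumes "1 \<le> n"
  shows "card {q \<in> {1..n} \<rightarrow>\<^sub>E (UNIV :: int set). height n q = k} \<le> 2 * n * (2 * k + 1) ^ (n - 1)"
proof -
  define P where "P = (\<lambda>i s. Pi\<^sub>E {1..n} (\<lambda>j. if j = i then {s} else {- int k..int k}))"
  have cP: "card (P i s) = (2 * k + 1) ^ (n - 1)" if i: "i \<in> {1..n}" for i s
  proof -
    have "card (P i s) = (\<Prod>j\<in>{1..n}. card (if j = i then {s} else {- int k..int k}))"
      unfolding P_def by (rule card_PiE) simp
    also have "\<dots> = (\<Prod>j\<in>{1..n} - {i}. card {- int k..int k})"
      using i by (subst prod.remove[of _ i]) auto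
    also have "\<dots> = (2 * k + 1) ^ (n - 1)"
    proof -
      have "card {- int k..int k} = 2 * k + 1" by simp
      then show ?thesis using i by (simp del: card_atLeastAtMost_int)
    qed
    finally show ?thesis .
  qed
  have "card {q \<in> {1..n} \<rightarrow>\<^sub>E (UNIV :: int set). height n q = k}
      \<le> card (\<Union>i\<in>{1..n}. \<Union>s\<in>{int k, - int k}. P i s)"
    unfolding P_def by (rule card_mono[OF _ height_eq_subset[OF assms]]) (auto intro!: finite_PiE)
  also have "\<dots> \<le> (\<Sum>i\<in>{1..n}. card (\<Union>s\<in>{int k, - int k}. P i s))"
    by (rule card_UN_le) simp
  also have "\<dots> \<le> (\<Sum>i\<in>{1..n}. \<Sum>s\<in>{int k, - int k}. card (P i s))"
    by (intro sum_mono card_UN_le) simp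
  also have "\<dots> = (\<Sum>i\<in>{1..n}. card {int k, - int k} * (2 * k + 1) ^ (n - 1))"
    by (intro sum.cong refl) (simp add: cP)
  \<comment> \<open>Only an inequality, as \<open>{k, - k}\<close> is a singleton for
    \<open>k = 0\<close>.\<close>
  also have "\<dots> \<le> (\<Sum>i\<in>{1..n}. 2 * (2 * k + 1) ^ (n - 1))"
    by (intro sum_mono mult_right_mono) (auto simp: card_insert_if)
  finally show ?thesis by simp
qed

section \<open>Parameter sets attached to integer vectors\<close>

text \<open>The coefficients are those of \<open>y \<cdot> q\<close> as an affine function of the
  parameter \<open>x\<close>, with \<open>y = graph_map n A x\<close>; see
  \<open>sum_graph_map\<close>.\<close>

definition hyperplane_slab ::
    "nat \<Rightarrow> (nat \<Rightarrow> real) \<Rightarrow> real \<Rightarrow> (nat \<Rightarrow> int) \<Rightarrow> real \<Rightarrow> (nat \<Rightarrow> real) set" where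
  "hyperplane_slab n A R q \<delta> =
     slab {1..<n} R (of_int (q n) * A 0) (\<lambda>i. of_int (q i) + of_int (q n) * A i) \<delta>"

lemma hyperplane_slab_measurable: "hyperplane_slab n A R q \<delta> \<in> sets (Pi\<^sub>M {1..<n} (\<lambda>_. lborel))"
  unfolding hyperplane_slab_def by (rule slab_measurable) simp

lemma sum_graph_map:
  assumes "1 \<le> n"
  shows "(\<Sum>i=1..n. graph_map n A x i * of_int (q i)) =
    of_int (q n) * A 0 + (\<Sum>i\<in>{1..<n}. (of_int (q i) + of_int (q n) * A i) * x i)"
proof -
  have I: "{1..n} = insert n {1..<n}" "{..<n} = insert 0 {1..<n}" using assms by auto
  have "tilde_mult n x A = A 0 + (\<Sum>i\<in>{1..<n}. x i * A i)"
    unfolding tilde_mult_def I(2) by (subst sum.insert) (auto intro!: sum.cong)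
  moreover have "(\<Sum>i=1..n. graph_map n A x i * of_int (q i))
      = tilde_mult n x A * of_int (q n) + (\<Sum>i\<in>{1..<n}. x i * of_int (q i))"
    unfolding I(1) graph_map_def by (subst sum.insert) (auto intro!: sum.cong)
  ultimately show ?thesis
    by (simp add: algebra_simps sum.distrib sum_distrib_left)
qed

lemma mem_hyperplane_slab_iff:
  assumes "1 \<le> n"
  shows "x \<in> hyperplane_slab n A R q \<delta> \<longleftrightarrow> x \<in> {1..<n} \<rightarrow>\<^sub>E {-R..R} \<and>
    (\<exists>p::int. \<bar>of_int p + (\<Sum>i=1..n. graph_map n A x i * of_int (q i))\<bar> < \<delta>)"
  unfolding hyperplane_slab_def slab_def sum_graph_map[OF assms] by (simp add: add.assoc)

text \<open>Among integer vectors with last coordinate \<open>m\<close>, this one makes every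
  gradient entry \<open>q i + m * A i\<close> as small as possible.\<close>

definition nearest_vector :: "nat \<Rightarrow> (nat \<Rightarrow> real) \<Rightarrow> int \<Rightarrow> (nat \<Rightarrow> int)" where
  "nearest_vector n A m = (\<lambda>i\<in>{1..n}. if i = n then m else - round (of_int m * A i))"

text \<open>The strict bound excludes ties, so \<open>- q i\<close> must be the rounding of
  \<open>q n * A i\<close>. Thus the remaining vectors form a family with the single parameter
  \<open>q n\<close>.\<close>

lemma eq_nearest_vector:
  assumes q: "q \<in> {1..n} \<rightarrow>\<^sub>E UNIV"
    and near: "\<And>i. i \<in> {1..<n} \<Longrightarrow> \<bar>of_int (q i) + of_int (q n) * A i\<bar> < 1 / 2"
  shows "q = nearest_vector n A (q n)"
proof
  fix i
  consider "i \<notin> {1..n}" | "i = n" "i \<in> {1..n}" | "i \<in> {1..<n}" "i \<in> {1..n}" "i \<noteq> n" by fastforce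
  then show "q i = nearest_vector n A (q n) i"
  proof cases
    case 1
    then show ?thesis unfolding nearest_vector_def using PiE_arb[OF q 1] by (simp only: restrict_apply if_False)
  next
    case 3
    have "round (of_int (q n) * A i) = - q i"
      using near[OF 3(1)] by (intro round_unique') (simp add: add.commute)
    then show ?thesis unfolding nearest_vector_def using 3 by simp
  qed (auto simp: nearest_vector_def)
qed

text \<open>Slicing along \<open>i\<close>, where \<open>3 / b \<le> 6\<close>, makes the constant
  independent of \<open>q\<close>.\<close>

lemma emeasure_far_slab_le:
  assumes R: "1 \<le> R" and d: "0 \<le> d" "d \<le> 1"
    and "i \<in> {1..<n}" "1 / 2 \<le> \<bar>of_int (q i) + of_int (q n) * A i\<bar>"
  shows "emeasure (Pi\<^sub>M {1..<n} (\<lambda>_. lborel)) (hyperplane_slab n A R q d)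
    \<le> ennreal ((2 * R) ^ (n - 2) * (2 * (2 * R + 6)) * d)"
proof -
  define b where "b = \<bar>of_int (q i) + of_int (q n) * A i\<bar>"
  have b: "1 / 2 \<le> b" using assms by (simp add: b_def)
  have "emeasure (Pi\<^sub>M {1..<n} (\<lambda>_. lborel)) (hyperplane_slab n A R q d)
    \<le> ennreal ((2 * R) ^ (card {1..<n} - 1) * (2 * d * (2 * R + 3 / b)))"
    unfolding hyperplane_slab_def b_def
    by (rule emeasure_slab_le) (use assms in auto)
  also have "\<dots> \<le> ennreal ((2 * R) ^ (n - 2) * (2 * (2 * R + 6)) * d)"
  proof (rule ennreal_leI)
    have "3 / b \<le> 6" using b by (simp add: field_simps)
    then have "(2 * R) ^ (n - 2) * (2 * d * (2 * R + 3 / b)) \<le> (2 * R) ^ (n - 2) * (2 * d * (2 * R + 6))"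
      using R d by (intro mult_left_mono) auto
    then show "(2 * R) ^ (card {1..<n} - 1) * (2 * d * (2 * R + 3 / b))
        \<le> (2 * R) ^ (n - 2) * (2 * (2 * R + 6)) * d"
      by (simp add: mult_ac numeral_2_eq_2)
  qed
  finally show ?thesis .
qed

text \<open>The gradient entries have absolute values \<open>int_dist (k * A i)\<close> for
  \<open>i \<ge> 1\<close>; let \<open>g\<close> be the largest. The distance \<Delta> might instead
  come from the constant term \<open>k * A 0\<close>, but a point of the slab shows that this term
  is within \<open>d + n * R * g\<close> of an integer. Either way \<Delta> is \<open>O(g)\<close>,
  and slicing along the coordinate of \<open>g\<close> gives the bound.\<close>

lemma emeasure_near_slab_le:
  assumes n: "2 \<le> n" and R: "1 \<le> R" and d: "0 \<le> d"
    and D: "d \<le> column_dist n A k / 2" "0 < column_dist n A k" and m: "nat \<bar>m\<bar> = k"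
  shows "emeasure (Pi\<^sub>M {1..<n} (\<lambda>_. lborel)) (hyperplane_slab n A R (nearest_vector n A m) d)
    \<le> ennreal ((2 * R) ^ (n - 2) * (2 * (2 * R + 6 * real n * R)) * (d / column_dist n A k))"
    (is "emeasure ?M ?S \<le> _")
proof (cases "?S = {}")
  case False
  define \<Delta> where "\<Delta> = column_dist n A k"
  define b where "b = (\<lambda>i. of_int (nearest_vector n A m i) + of_int (nearest_vector n A m n) * A i)"
  \<comment> \<open>\<open>m\<close> is \<open>k\<close> or \<open>- k\<close>, and the distance to
    the integers is an even function.\<close>
  have dist: "int_dist (of_int m * t) = int_dist (real k * t)" for t
    using m int_dist_minus[of "of_int m * t"] by (cases "0 \<le> m") auto
  have nv: "nearest_vector n A m n = m" using n by (simp add: nearest_vector_def)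
  have b: "\<bar>b i\<bar> = int_dist (real k * A i)" if "i \<in> {1..<n}" for i
    unfolding b_def nv dist[symmetric] using that
    by (auto simp: nearest_vector_def int_dist_def)
  define g where "g = (MAX i\<in>{1..<n}. \<bar>b i\<bar>)"
  have "g \<in> (\<lambda>i. \<bar>b i\<bar>) ` {1..<n}" unfolding g_def using n by (intro Max_in) auto
  then obtain j where j: "j \<in> {1..<n}" "g = \<bar>b j\<bar>" by auto
  have bg: "\<bar>b i\<bar> \<le> g" if "i \<in> {1..<n}" for i unfolding g_def using that by (intro Max_ge) auto
  from False obtain x p where x: "x \<in> {1..<n} \<rightarrow>\<^sub>E {-R..R}"
    and p: "\<bar>of_int p + of_int m * A 0 + (\<Sum>i\<in>{1..<n}. b i * x i)\<bar> < d"
    unfolding hyperplane_slab_def slab_def nv b_def by auto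
  have g0: "0 \<le> g" using j by simp
  have "\<bar>\<Sum>i\<in>{1..<n}. b i * x i\<bar> \<le> (\<Sum>i\<in>{1..<n}. g * R)"
  proof (rule order_trans[OF sum_abs sum_mono])
    fix i assume i: "i \<in> {1..<n}"
    then have "x i \<in> {-R..R}" using x by blast
    then have "\<bar>x i\<bar> \<le> R" by (simp add: abs_le_iff minus_le_iff)
    then show "\<bar>b i * x i\<bar> \<le> g * R" unfolding abs_mult using bg[OF i] g0 by (intro mult_mono) auto
  qed
  also have "\<dots> = real (n - 1) * (g * R)" by simp
  also have "\<dots> \<le> real n * (g * R)" using g0 R by (intro mult_right_mono) auto
  finally have "\<bar>of_int m * A 0 - of_int (- p)\<bar> \<le> d + n * R * g" using p by (simp add: mult_ac)
  then have d0: "int_dist (real k * A 0) \<le> d + n * R * g"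
    using int_dist_le[of "of_int m * A 0" "- p"] by (simp add: dist)
  obtain i where i: "i < n" "\<Delta> = int_dist (real k * A i)"
    unfolding \<Delta>_def using column_dist_attained[of n A k] n by auto
  have "1 * g \<le> 2 * n * R * g"
  proof (rule mult_right_mono)
    have "1 * 1 \<le> real (2 * n) * R" using n R by (intro mult_mono) auto
    then show "1 \<le> 2 * n * R" by simp
  qed (rule g0)
  \<comment> \<open>The alternatives are a maximum \<Delta> attained at some
    \<open>i \<ge> 1\<close>, and one attained at 0, where \<open>d \<le> \<Delta> / 2\<close> can
    be absorbed on the left.\<close>
  moreover have "\<Delta> \<le> g \<or> \<Delta> \<le> \<Delta> / 2 + n * R * g"
    using i b[of i] bg[of i] d0 D(1) by (cases "i = 0") (auto simp: \<Delta>_def)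
  ultimately have Dg: "\<Delta> \<le> 2 * n * R * g" by auto
  have D0: "0 < \<Delta>" "\<Delta> \<le> 1" using D(2) column_dist_le_1[of n A k] n by (auto simp: \<Delta>_def)
  have gpos: "0 < g" using Dg D0 g0 by (cases "g = 0") auto
  have "emeasure ?M ?S \<le> ennreal ((2 * R) ^ (card {1..<n} - 1) * (2 * d * (2 * R + 3 / \<bar>b j\<bar>)))"
    unfolding hyperplane_slab_def b_def
    by (rule emeasure_slab_le) (use j gpos R d D D0 in \<open>auto simp: b_def \<Delta>_def\<close>)
  also have "\<dots> \<le> ennreal ((2 * R) ^ (n - 2) * (2 * (2 * R + 6 * real n * R)) * (d / \<Delta>))"
  proof (rule ennreal_leI)
    \<comment> \<open>\<open>\<Delta> \<le> 1\<close> lets the term \<open>2 * R\<close> be bounded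
      by a multiple of \<open>1 / \<Delta>\<close>.\<close>
    have "2 * R * \<Delta> \<le> 2 * R * 1" using R D0 by (intro mult_left_mono) auto
    then have "2 * R \<le> 2 * R / \<Delta>" using D0 by (simp add: field_simps)
    moreover have "3 / g \<le> 6 * real n * R / \<Delta>" using Dg D0 gpos by (simp add: field_simps)
    ultimately have "2 * R + 3 / g \<le> (2 * R + 6 * real n * R) / \<Delta>" by (simp add: add_divide_distrib)
    then have "(2 * R) ^ (n - 2) * (2 * d * (2 * R + 3 / g))
        \<le> (2 * R) ^ (n - 2) * (2 * d * ((2 * R + 6 * real n * R) / \<Delta>))"
      using R d by (intro mult_left_mono) auto
    then show "(2 * R) ^ (card {1..<n} - 1) * (2 * d * (2 * R + 3 / \<bar>b j\<bar>))
        \<le> (2 * R) ^ (n - 2) * (2 * (2 * R + 6 * real n * R)) * (d / \<Delta>)"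
      by (simp add: mult_ac numeral_2_eq_2 j(2))
  qed
  finally show ?thesis by (simp add: \<Delta>_def)
qed simp

section \<open>Borel-Cantelli for the two families of integer vectors\<close>

text \<open>There are \<open>O(k ^ (n - 1))\<close> vectors of height \<open>k\<close>, each with a
  slab of measure \<open>O(\<psi> k)\<close>, so the given series dominates the measures of the
  events.\<close>

lemma AE_eventually_not_far:
  assumes n: "2 \<le> n" and R: "1 \<le> R" and nonneg: "\<forall>k\<ge>1. 0 \<le> \<psi> k"
    and le1: "\<forall>\<^sub>F k in sequentially. \<psi> k \<le> 1"
    and sum: "summable (\<lambda>k. real (Suc k) ^ (n - 1) * \<psi> (Suc k))"
  shows "AE x in Pi\<^sub>M {1..<n} (\<lambda>_. lborel). \<forall>\<^sub>F k in sequentially.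
    \<forall>q \<in> {1..n} \<rightarrow>\<^sub>E UNIV. height n q = k \<longrightarrow>
      (\<exists>i\<in>{1..<n}. 1 / 2 \<le> \<bar>of_int (q i) + of_int (q n) * A i\<bar>) \<longrightarrow>
      x \<notin> hyperplane_slab n A R q (\<psi> k)"
proof -
  note nonneg = nonneg[rule_format]
  let ?M = "Pi\<^sub>M {1..<n} (\<lambda>_. lborel :: real measure)"
  define Q where "Q = (\<lambda>k. {q \<in> {1..n} \<rightarrow>\<^sub>E UNIV. height n q = k \<and>
      (\<exists>i\<in>{1..<n}. 1 / 2 \<le> \<bar>of_int (q i) + of_int (q n) * A i\<bar>)})"
  define E where "E = (\<lambda>k. \<Union>q\<in>Q k. hyperplane_slab n A R q (\<psi> k))"
  define D where "D = (2 * R) ^ (n - 2) * (2 * (2 * R + 6))"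
  define f where "f = (\<lambda>k. D * (2 * n * 3 ^ (n - 1)) * (real k ^ (n - 1) * \<psi> k))"
  have n1: "1 \<le> n" using n by simp
  have D0: "0 \<le> D" using R by (simp add: D_def)
  have finQ: "finite (Q k)" for k
    by (rule finite_subset[OF _ finite_height_eq[OF n1, of k]]) (auto simp: Q_def)
  have cardQ: "real (card (Q k)) \<le> 2 * n * 3 ^ (n - 1) * real k ^ (n - 1)" if k: "1 \<le> k" for k
  proof -
    have "card (Q k) \<le> card {q \<in> {1..n} \<rightarrow>\<^sub>E (UNIV :: int set). height n q = k}"
      by (rule card_mono[OF finite_height_eq[OF n1]]) (auto simp: Q_def)
    also have "\<dots> \<le> 2 * n * (2 * k + 1) ^ (n - 1)" by (rule card_height_eq_le[OF n1])
    also have "\<dots> \<le> 2 * n * (3 * k) ^ (n - 1)" using k by (intro mult_left_mono power_mono) auto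
    finally have "card (Q k) \<le> 2 * n * 3 ^ (n - 1) * k ^ (n - 1)" by (simp add: power_mult_distrib)
    then have "real (card (Q k)) \<le> real (2 * n * 3 ^ (n - 1) * k ^ (n - 1))" by (rule of_nat_mono)
    then show ?thesis by simp
  qed
  from le1 obtain K where K: "\<And>k. K \<le> k \<Longrightarrow> \<psi> k \<le> 1" by (auto simp: eventually_sequentially)
  have "AE x in ?M. \<forall>\<^sub>F k in sequentially. x \<notin> E k"
  proof (rule borel_cantelli_AE_le)
    show "E k \<in> sets ?M" for k
      unfolding E_def using finQ by (intro sets.finite_UN hyperplane_slab_measurable)
    show "emeasure ?M (E k) \<le> ennreal (f k)" if k: "max K 1 \<le> k" for k
    proof -
      have "emeasure ?M (E k) \<le> (\<Sum>q\<in>Q k. emeasure ?M (hyperplane_slab n A R q (\<psi> k)))"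
        unfolding E_def using finQ
        by (intro emeasure_subadditive_finite image_subsetI hyperplane_slab_measurable)
      also have "\<dots> \<le> (\<Sum>q\<in>Q k. ennreal (D * \<psi> k))"
      proof (rule sum_mono)
        fix q assume "q \<in> Q k"
        then obtain i where "i \<in> {1..<n}" "1 / 2 \<le> \<bar>of_int (q i) + of_int (q n) * A i\<bar>"
          by (auto simp: Q_def)
        then show "emeasure ?M (hyperplane_slab n A R q (\<psi> k)) \<le> ennreal (D * \<psi> k)"
          unfolding D_def using k K nonneg by (intro emeasure_far_slab_le R) auto
      qed
      also have "\<dots> = ennreal (real (card (Q k)) * (D * \<psi> k))"
        using nonneg k D0 by (simp add: ennreal_of_nat_eq_real_of_nat flip: ennreal_mult'')
      also have "\<dots> \<le> ennreal (f k)"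
      proof (rule ennreal_leI)
        have "real (card (Q k)) * (D * \<psi> k) \<le> (2 * n * 3 ^ (n - 1) * real k ^ (n - 1)) * (D * \<psi> k)"
          using cardQ nonneg k D0 by (intro mult_right_mono) auto
        then show "real (card (Q k)) * (D * \<psi> k) \<le> f k" by (simp add: f_def mult_ac)
      qed
      finally show ?thesis .
    qed
    show "0 \<le> f k" if "max K 1 \<le> k" for k
      unfolding f_def using that D0 nonneg by (intro mult_nonneg_nonneg) auto
    have "summable (\<lambda>k. real k ^ (n - 1) * \<psi> k)"
      using summable_Suc_iff[of "\<lambda>k. real k ^ (n - 1) * \<psi> k"] sum by simp
    then show "summable f" unfolding f_def by (rule summable_mult)
  qed
  then show ?thesis
  proof eventually_elim
    fix x assume "\<forall>\<^sub>F k in sequentially. x \<notin> E k"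
    then show "\<forall>\<^sub>F k in sequentially. \<forall>q \<in> {1..n} \<rightarrow>\<^sub>E UNIV. height n q = k \<longrightarrow>
      (\<exists>i\<in>{1..<n}. 1 / 2 \<le> \<bar>of_int (q i) + of_int (q n) * A i\<bar>) \<longrightarrow>
      x \<notin> hyperplane_slab n A R q (\<psi> k)"
      by (rule eventually_mono) (auto simp: E_def Q_def)
  qed
qed

text \<open>The events are indexed by the size \<open>k\<close> of the last coordinate instead of
  the height, so only \<open>m = k\<close> and \<open>m = - k\<close> enter. Each slab has measure
  \<open>O(\<psi> k / column_dist n A k)\<close>, and the bound \<open>C\<close> turns this into a
  term of the series in \<open>sum\<close>.\<close>

lemma AE_eventually_not_near:
  assumes n: "2 \<le> n" and R: "1 \<le> R" and nonneg: "\<forall>k\<ge>1. 0 \<le> \<psi> k"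
    and C: "0 < C" "\<forall>k\<ge>1. real k ^ n * \<psi> k \<le> C"
    and pos: "\<forall>k\<ge>1. 0 < column_dist n A k"
    and small: "\<forall>\<^sub>F k in sequentially. \<psi> k \<le> column_dist n A k / 2"
    and sum: "summable (\<lambda>k. 1 / (real k ^ n * column_dist n A k))"
  shows "AE x in Pi\<^sub>M {1..<n} (\<lambda>_. lborel). \<forall>\<^sub>F k in sequentially.
    \<forall>m. nat \<bar>m\<bar> = k \<longrightarrow> x \<notin> hyperplane_slab n A R (nearest_vector n A m) (\<psi> k)"
proof -
  note nonneg = nonneg[rule_format] and C = C[rule_format] and pos = pos[rule_format]
  let ?M = "Pi\<^sub>M {1..<n} (\<lambda>_. lborel :: real measure)"
  define T where "T = (\<lambda>k m. hyperplane_slab n A R (nearest_vector n A m) (\<psi> k))"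
  define E where "E = (\<lambda>k. T k (int k) \<union> T k (- int k))"
  define D where "D = (2 * R) ^ (n - 2) * (2 * (2 * R + 6 * real n * R))"
  define f where "f = (\<lambda>k. 2 * D * C * (1 / (real k ^ n * column_dist n A k)))"
  have D0: "0 \<le> D" using R by (simp add: D_def)
  have T: "T k m \<in> sets ?M" for k m unfolding T_def by (rule hyperplane_slab_measurable)
  from small obtain K where K: "\<And>k. K \<le> k \<Longrightarrow> \<psi> k \<le> column_dist n A k / 2"
    by (auto simp: eventually_sequentially)
  have "AE x in ?M. \<forall>\<^sub>F k in sequentially. x \<notin> E k"
  proof (rule borel_cantelli_AE_le)
    show "E k \<in> sets ?M" for k unfolding E_def using T by blast
    show "emeasure ?M (E k) \<le> ennreal (f k)" if k: "max K 1 \<le> k" for k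
    proof -
      have *: "emeasure ?M (T k m) \<le> ennreal (f k / 2)" if m: "nat \<bar>m\<bar> = k" for m
      proof -
        have "emeasure ?M (T k m) \<le> ennreal (D * (\<psi> k / column_dist n A k))"
          unfolding T_def D_def using k
          by (intro emeasure_near_slab_le n R nonneg K pos m) auto
        also have "\<dots> \<le> ennreal (f k / 2)"
        proof (rule ennreal_leI)
          have "\<psi> k \<le> C / real k ^ n" using C(2)[of k] k by (simp add: field_simps)
          then have "D * (\<psi> k / column_dist n A k) \<le> D * ((C / real k ^ n) / column_dist n A k)"
            using D0 pos[of k] k by (intro mult_left_mono divide_right_mono) auto
          then show "D * (\<psi> k / column_dist n A k) \<le> f k / 2" by (simp add: f_def)
        qed
        finally show ?thesis .
      qed
      have "0 \<le> f k" using D0 C(1) pos[of k] k by (simp add: f_def)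
      have "emeasure ?M (E k) \<le> emeasure ?M (T k (int k)) + emeasure ?M (T k (- int k))"
        unfolding E_def by (rule emeasure_subadditive) (rule T)+
      also have "\<dots> \<le> ennreal (f k / 2) + ennreal (f k / 2)"
        by (intro add_mono *) auto
      also have "\<dots> = ennreal (f k)" using \<open>0 \<le> f k\<close> by (simp flip: ennreal_plus)
      finally show ?thesis .
    qed
    show "0 \<le> f k" if "max K 1 \<le> k" for k
      using D0 C(1) pos[of k] that by (simp add: f_def)
    show "summable f" unfolding f_def by (rule summable_mult[OF sum])
  qed
  then show ?thesis
  proof eventually_elim
    fix x assume "\<forall>\<^sub>F k in sequentially. x \<notin> E k"
    then show "\<forall>\<^sub>F k in sequentially. \<forall>m. nat \<bar>m\<bar> = k \<longrightarrow>
        x \<notin> hyperplane_slab n A R (nearest_vector n A m) (\<psi> k)"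
    proof (rule eventually_mono)
      fix k assume k: "x \<notin> E k"
      show "\<forall>m. nat \<bar>m\<bar> = k \<longrightarrow> x \<notin> hyperplane_slab n A R (nearest_vector n A m) (\<psi> k)"
      proof safe
        fix m assume m: "k = nat \<bar>m\<bar>" "x \<in> hyperplane_slab n A R (nearest_vector n A m) (\<psi> (nat \<bar>m\<bar>))"
        have "m = int k \<or> m = - int k" using m(1) by auto
        then have "x \<in> E k" using m unfolding E_def T_def by auto
        then show False using k by simp
      qed
    qed
  qed
qed

text \<open>For almost every \<open>x\<close>, a solution \<open>q\<close> of height at least
  \<open>K1\<close> is a nearest vector, hence determined by \<open>q n\<close>, and then
  \<open>q n\<close> is bounded in terms of \<open>K2\<close>. This leaves finitely many heights and
  finitely many last coordinates.\<close>

lemma AE_finite_approximations_in_box: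
  fixes \<psi> :: "nat \<Rightarrow> real"
  assumes n: "2 \<le> n" and R: "1 \<le> R"
    and anti: "antimono_on {1..} \<psi>" and nonneg: "\<forall>k\<ge>1. 0 \<le> \<psi> k"
    and sum: "summable (\<lambda>k. real (Suc k) ^ (n - 1) * \<psi> (Suc k))"
    and A: "A \<in> column_matrices n" "A \<notin> W_minus_set (real n) n"
  shows "AE x in Pi\<^sub>M {1..<n} (\<lambda>_. lborel). x \<in> {1..<n} \<rightarrow>\<^sub>E {-R..R} \<longrightarrow>
    finite {q \<in> {1..n} \<rightarrow>\<^sub>E (UNIV :: int set). \<exists>p :: int.
       \<bar>of_int p + (\<Sum>i=1..n. graph_map n A x i * of_int (q i))\<bar> < \<psi> (height n q)}"
proof -
  have n1: "1 \<le> n" using n by simp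
  obtain u c where u: "0 < u" "u < real n" and c: "0 < c"
    and low: "\<And>m. 1 \<le> m \<Longrightarrow> c * real m powr (-u) \<le> column_dist n A m"
    using column_dist_lower_bound[OF n1 A] by blast
  have pos: "\<forall>k\<ge>1. 0 < column_dist n A k"
  proof safe
    fix k :: nat assume k: "1 \<le> k"
    have "0 < c * real k powr (-u)" using c k by simp
    then show "0 < column_dist n A k" using low[OF k] by linarith
  qed
  have le1: "column_dist n A m \<le> 1" for m by (rule column_dist_le_1[OF n1])
  obtain C where C: "0 < C" "\<forall>k\<ge>1. real k ^ n * \<psi> k \<le> C"
    using antimono_summable_bound[OF anti nonneg[rule_format] sum] n by auto
  \<comment> \<open>\<open>\<psi> k \<le> C * k powr (-n)\<close> decays faster than
    \<open>c * k powr (-u)\<close>, as \<open>u < n\<close>. This yields the condition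
    \<open>d \<le> column_dist n A k / 2\<close> of \<open>emeasure_near_slab_le\<close>.\<close>
  have "((\<lambda>k. C * real k powr (u - real n)) \<longlongrightarrow> C * 0) sequentially"
    using u by (intro tendsto_mult tendsto_const tendsto_neg_powr filterlim_real_sequentially) auto
  then have "\<forall>\<^sub>F k in sequentially. C * real k powr (u - real n) < c / 2"
    using c by (intro order_tendstoD(2)[where y = "C * 0"]) auto
  then have small: "\<forall>\<^sub>F k in sequentially. \<psi> k \<le> column_dist n A k / 2"
    using eventually_ge_at_top[of 1]
  proof eventually_elim
    fix k :: nat assume k: "C * real k powr (u - real n) < c / 2" "1 \<le> k"
    have "\<psi> k \<le> C / real k ^ n" using C(2)[rule_format, OF k(2)] k(2) by (simp add: field_simps)
    also have "\<dots> = C * real k powr (u - real n) * real k powr (-u)"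
      using k(2) by (simp add: powr_diff powr_minus powr_realpow field_simps)
    also have "\<dots> \<le> c / 2 * real k powr (-u)" using k by (intro mult_right_mono) auto
    also have "\<dots> \<le> column_dist n A k / 2" using low[OF k(2)] by simp
    finally show "\<psi> k \<le> column_dist n A k / 2" .
  qed
  then have small1: "\<forall>\<^sub>F k in sequentially. \<psi> k \<le> 1"
    by (rule eventually_mono) (use le1 in \<open>smt (verit) field_sum_of_halves\<close>)
  have "summable (\<lambda>k. 1 / (real k ^ n * column_dist n A k))"
    using column_dist_diff[OF n1] le1
    by (intro summable_inverse_power_divide_badly_approximable[OF n u c low]) auto
  note near = AE_eventually_not_near[OF n R nonneg C pos small this]
  show ?thesis
    using AE_eventually_not_far[OF n R nonneg small1 sum, of A] near
  proof eventually_elim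
    fix x assume far': "\<forall>\<^sub>F k in sequentially. \<forall>q \<in> {1..n} \<rightarrow>\<^sub>E UNIV. height n q = k \<longrightarrow>
      (\<exists>i\<in>{1..<n}. 1 / 2 \<le> \<bar>of_int (q i) + of_int (q n) * A i\<bar>) \<longrightarrow>
      x \<notin> hyperplane_slab n A R q (\<psi> k)"
    and near': "\<forall>\<^sub>F k in sequentially. \<forall>m. nat \<bar>m\<bar> = k \<longrightarrow>
      x \<notin> hyperplane_slab n A R (nearest_vector n A m) (\<psi> k)"
    from far'[unfolded eventually_sequentially] obtain K1 where K1: "\<forall>k\<ge>K1. \<forall>q \<in> {1..n} \<rightarrow>\<^sub>E UNIV. height n q = k \<longrightarrow>
      (\<exists>i\<in>{1..<n}. 1 / 2 \<le> \<bar>of_int (q i) + of_int (q n) * A i\<bar>) \<longrightarrow>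
      x \<notin> hyperplane_slab n A R q (\<psi> k)"
      ..
    have far: "\<bar>of_int (q i) + of_int (q n) * A i\<bar> < 1 / 2"
      if "q \<in> {1..n} \<rightarrow>\<^sub>E UNIV" "K1 \<le> height n q" "i \<in> {1..<n}"
        "x \<in> hyperplane_slab n A R q (\<psi> (height n q))" for q i
      using K1[rule_format, OF that(2) that(1) refl] that(3,4) not_le by blast
    from near'[unfolded eventually_sequentially] obtain K2 where K2: "\<forall>k\<ge>K2. \<forall>m. nat \<bar>m\<bar> = k \<longrightarrow>
        x \<notin> hyperplane_slab n A R (nearest_vector n A m) (\<psi> k)"
      ..
    have near: "x \<notin> hyperplane_slab n A R (nearest_vector n A m) (\<psi> (nat \<bar>m\<bar>))"
      if "K2 \<le> nat \<bar>m\<bar>" for m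
      using K2[rule_format, OF that refl] .
    let ?S = "{q \<in> {1..n} \<rightarrow>\<^sub>E (UNIV :: int set). \<exists>p :: int.
       \<bar>of_int p + (\<Sum>i=1..n. graph_map n A x i * of_int (q i))\<bar> < \<psi> (height n q)}"
    \<comment> \<open>The 1 keeps \<open>\<bar>q n\<bar>\<close> in the range \<open>{1..}\<close>
      on which \<psi> is monotone.\<close>
    let ?K = "int (max K2 1)"
    show "x \<in> {1..<n} \<rightarrow>\<^sub>E {-R..R} \<longrightarrow> finite ?S"
    proof
      assume x: "x \<in> {1..<n} \<rightarrow>\<^sub>E {-R..R}"
      have "?S \<subseteq> (\<Union>k<K1. {q \<in> {1..n} \<rightarrow>\<^sub>E UNIV. height n q = k}) \<union> nearest_vector n A ` {-?K..?K}"
      proof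
        fix q assume q: "q \<in> ?S"
        then have qslab: "x \<in> hyperplane_slab n A R q (\<psi> (height n q))"
          using x by (simp add: mem_hyperplane_slab_iff[OF n1])
        show "q \<in> (\<Union>k<K1. {q \<in> {1..n} \<rightarrow>\<^sub>E UNIV. height n q = k}) \<union> nearest_vector n A ` {-?K..?K}"
        proof (cases "height n q < K1")
          case False
          then have qn: "q = nearest_vector n A (q n)"
            using q qslab far by (intro eq_nearest_vector) auto
          have "\<bar>q n\<bar> \<le> ?K"
          proof (rule ccontr)
            assume big: "\<not> \<bar>q n\<bar> \<le> ?K"
            \<comment> \<open>The near events are defined with \<psi> at
              \<open>\<bar>q n\<bar>\<close>; since this is at most the height, the slab for the
              height lies inside theirs.\<close>
            have "nat \<bar>q n\<bar> \<le> height n q" using n1 by (intro abs_le_height) auto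
            then have "\<psi> (height n q) \<le> \<psi> (nat \<bar>q n\<bar>)"
              using anti big by (intro monotone_onD[OF anti]) auto
            then have "x \<in> hyperplane_slab n A R q (\<psi> (nat \<bar>q n\<bar>))"
              using qslab unfolding mem_hyperplane_slab_iff[OF n1] by (meson less_le_trans)
            then have "x \<in> hyperplane_slab n A R (nearest_vector n A (q n)) (\<psi> (nat \<bar>q n\<bar>))"
              using qn by simp
            then show False using near[of "q n"] big by auto
          qed
          then have "q n \<in> {-?K..?K}" by auto
          then show ?thesis using qn by blast
        qed (use q in auto)
      qed
      then show "finite ?S"
        by (rule finite_subset) (use finite_height_eq[OF n1] in auto)
    qed
  qed
qed

section \<open>Volume on the hyperplane\<close>

text \<open>A set is infinite when no finite set exhausts it. For countable \<open>Q\<close> there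
  are only countably many finite \<open>F\<close>, so this form exhibits the set of approximable
  points as a countable intersection of countable unions.\<close>

lemma infinite_Collect_iff:
  "infinite {q \<in> Q. P q} \<longleftrightarrow> (\<forall>F\<in>{F. finite F \<and> F \<subseteq> Q}. \<exists>q\<in>Q - F. P q)"
proof
  assume i: "infinite {q \<in> Q. P q}"
  show "\<forall>F\<in>{F. finite F \<and> F \<subseteq> Q}. \<exists>q\<in>Q - F. P q"
  proof
    fix F assume "F \<in> {F. finite F \<and> F \<subseteq> Q}"
    then have "infinite ({q \<in> Q. P q} - F)" using i by auto
    then have "{q \<in> Q. P q} - F \<noteq> {}" by (rule infinite_imp_nonempty)
    then show "\<exists>q\<in>Q - F. P q" by blast
  qed
qed (auto dest!: bspec[of _ _ "{q \<in> Q. P q}"])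

lemma approximable_points_measurable:
  assumes "1 \<le> n"
  shows "approximable_points n (hyperplane n A) \<psi> \<in>
    sets (restrict_space (Pi\<^sub>M {1..n} (\<lambda>_. borel)) (hyperplane n A))"
proof -
  let ?N = "Pi\<^sub>M {1..n} (\<lambda>_. borel :: real measure)"
  let ?Q = "{1..n} \<rightarrow>\<^sub>E (UNIV :: int set)"
  let ?P = "\<lambda>q y. \<exists>p :: int. \<bar>of_int p + (\<Sum>i=1..n. y i * of_int (q i))\<bar> < \<psi> (MAX i\<in>{1..n}. nat \<bar>q i\<bar>)"
  have cQ: "countable ?Q" by (intro countable_PiE) auto
  define FF where "FF = {F. finite F \<and> F \<subseteq> ?Q}"
  have cF: "countable FF"
    using countable_Collect_finite_subset[OF cQ] by (simp add: FF_def)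
  have inf_iff: "infinite {q \<in> ?Q. ?P q y} \<longleftrightarrow> (\<forall>F\<in>FF. \<exists>q\<in>?Q - F. ?P q y)" for y
    unfolding FF_def by (rule infinite_Collect_iff)
  have "{y \<in> space ?N. infinite {q \<in> ?Q. ?P q y}} \<in> sets ?N"
    unfolding inf_iff
  proof (intro sets.sets_Collect_countable_All' sets.sets_Collect_countable_Ex' cF)
    show "countable (?Q - F)" for F using cQ by (rule countable_subset[rotated]) auto
    show "{y \<in> space ?N. ?P q y} \<in> sets ?N" for q
      by measurable
  qed
  moreover have "graph_map n A x \<in> space ?N" if "x \<in> {1..<n} \<rightarrow>\<^sub>E UNIV" for x
    using that assms by (auto simp: graph_map_def space_PiM PiE_iff extensional_def)
  then have "approximable_points n (hyperplane n A) \<psi> =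
      hyperplane n A \<inter> {y \<in> space ?N. infinite {q \<in> ?Q. ?P q y}}"
    unfolding approximable_points_def hyperplane_def by blast
  ultimately show ?thesis unfolding sets_restrict_space by blast
qed

theorem theorem1p6:
  fixes n :: nat and \<psi> :: "nat \<Rightarrow> real" and A :: "nat \<Rightarrow> real"
  assumes "n \<ge> 1"
    and "antimono_on {1..} \<psi>"
    and "A \<in> column_matrices n"
    and "A \<notin> W_minus_set (real n) n"
    and "(\<Sum>k. ereal (real (Suc k) ^ (n - 1) * \<psi> (Suc k))) < \<infinity>"
  shows "approximable_points n (hyperplane n A) \<psi> \<in> null_sets (hyperplane_volume n A)"
proof -
  let ?S = "approximable_points n (hyperplane n A) \<psi>"
  let ?M = "Pi\<^sub>M {1..<n} (\<lambda>_. lborel :: real measure)"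
  let ?Q = "\<lambda>x. {q \<in> {1..n} \<rightarrow>\<^sub>E (UNIV :: int set). \<exists>p :: int.
       \<bar>of_int p + (\<Sum>i=1..n. graph_map n A x i * of_int (q i))\<bar> < \<psi> (height n q)}"
  \<comment> \<open>In dimension 1 Dirichlet's theorem contradicts the hypothesis on
    \<open>A\<close>; from here on there is a coordinate to slice along.\<close>
  have n: "2 \<le> n"
  proof (rule ccontr)
    assume "\<not> 2 \<le> n"
    then have "n = 1" using assms(1) by simp
    then show False using W_minus_set_one assms(3,4) by simp
  qed
  have mem: "graph_map n A x \<in> ?S \<longleftrightarrow> infinite (?Q x)" if "x \<in> {1..<n} \<rightarrow>\<^sub>E UNIV" for x
    unfolding approximable_points_def height_def hyperplane_def using that by simp
  have AE: "AE x in ?M. graph_map n A x \<notin> ?S"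
  \<comment> \<open>If \<psi> is negative somewhere, it stays negative by monotonicity, and only
    finitely many heights admit a solution at all.\<close>
  proof (cases "\<forall>k\<ge>1. 0 \<le> \<psi> k")
    case True
    have sum: "summable (\<lambda>k. real (Suc k) ^ (n - 1) * \<psi> (Suc k))"
      using assms(5) True by (intro summable_ereal) auto
    \<comment> \<open>Countably many boxes exhaust the parameter space; \<open>Suc N\<close> makes
      each half side at least 1.\<close>
    have "AE x in ?M. \<forall>N::nat. x \<in> {1..<n} \<rightarrow>\<^sub>E {- real (Suc N)..real (Suc N)} \<longrightarrow> finite (?Q x)"
      unfolding AE_all_countable
      by (intro allI AE_finite_approximations_in_box n assms(2-4) True sum) simp
    then show ?thesis
    proof (rule AE_mp, intro AE_I2 impI)
      fix x assume x: "x \<in> space ?M"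
        and fin: "\<forall>N::nat. x \<in> {1..<n} \<rightarrow>\<^sub>E {- real (Suc N)..real (Suc N)} \<longrightarrow> finite (?Q x)"
      define N where "N = nat \<lceil>\<Sum>i\<in>{1..<n}. \<bar>x i\<bar>\<rceil>"
      have "x i \<in> {- real (Suc N)..real (Suc N)}" if "i \<in> {1..<n}" for i
      proof -
        have "\<bar>x i\<bar> \<le> (\<Sum>i\<in>{1..<n}. \<bar>x i\<bar>)" using that by (intro member_le_sum) auto
        also have "\<dots> \<le> real N" unfolding N_def by (rule real_nat_ceiling_ge)
        finally show ?thesis by (simp add: abs_le_iff)
      qed
      then have "x \<in> {1..<n} \<rightarrow>\<^sub>E {- real (Suc N)..real (Suc N)}"
        using x by (auto simp: space_PiM PiE_iff)
      then show "graph_map n A x \<notin> ?S" using fin mem x by (auto simp: space_PiM)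
    qed
  next
    case False
    then obtain K where K: "1 \<le> K" "\<psi> K < 0" by force
    have "?Q x \<subseteq> (\<Union>k<K. {q \<in> {1..n} \<rightarrow>\<^sub>E UNIV. height n q = k})" for x
    proof safe
      fix q and p :: int
      assume q: "q \<in> {1..n} \<rightarrow>\<^sub>E (UNIV :: int set)"
        "\<bar>of_int p + (\<Sum>i=1..n. graph_map n A x i * of_int (q i))\<bar> < \<psi> (height n q)"
      have "height n q < K"
      proof (rule ccontr)
        assume "\<not> height n q < K"
        then have "\<psi> (height n q) \<le> \<psi> K" using K by (intro monotone_onD[OF assms(2)]) auto
        then show False using q K by linarith
      qed
      then show "q \<in> (\<Union>k<K. {q \<in> {1..n} \<rightarrow>\<^sub>E UNIV. height n q = k})" using q by blast
    qed
    then have "finite (?Q x)" for x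
      by (rule finite_subset) (use finite_height_eq[OF assms(1)] in auto)
    then show ?thesis by (intro AE_I2) (simp add: mem space_PiM)
  qed
  \<comment> \<open>The volume of a set is a constant multiple of the measure of its parameters, so
    a null set of parameters suffices.\<close>
  have "emeasure ?M {x \<in> {1..<n} \<rightarrow>\<^sub>E UNIV. graph_map n A x \<in> ?S} = 0"
    using emeasure_eq_0_AE[of "\<lambda>x. graph_map n A x \<in> ?S" ?M] AE by (simp add: space_PiM)
  moreover have S: "?S \<in> sets (restrict_space (Pi\<^sub>M {1..n} (\<lambda>_. borel)) (hyperplane n A))"
    by (rule approximable_points_measurable[OF assms(1)])
  ultimately have "emeasure (hyperplane_volume n A) ?S = 0"
    by (simp add: emeasure_hyperplane_volume[OF assms(1)])
  moreover have "?S \<in> sets (hyperplane_volume n A)" using S by (simp add: hyperplane_volume_def)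
  ultimately show ?thesis by (rule null_setsI)
qed

end
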